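(* Let $\mathcal{H}$ be a real Hilbert space, let $f\in\Gamma_0(\mathcal{H})$ with $\operatorname{int}\operatorname{dom} f\neq\varnothing$ be Gâteaux differentiable on $\operatorname{int}\operatorname{dom} f$, let $m\ge 1$, and let $\mathcal{S}=\{q_0,q_1,\dots,q_m\}\subseteq\operatorname{int}\operatorname{dom} f$. Suppose that $\nabla f(q_0),\nabla f(q_1),\dots,\nabla f(q_m)$ are affinely independent and that $\operatorname{aff}(\nabla f(\mathcal{S}))\subseteq\operatorname{dom} f$. Then $\overleftarrow{CC}^{ps}_f(\mathcal{S})\neq\varnothing$; moreover, $\overleftarrow{CC}^{ps}_f(\mathcal{S})$ is the singleton whose unique element is $$\nabla f(q_0)+\alpha_1(\nabla f(q_1)-\nabla f(q_0))+\cdots+\alpha_m(\nabla f(q_m)-\nabla f(q_0)),$$ where $$\begin{pmatrix}\alpha_1\\ \vdots\\ \alpha_m\end{pmatrix}=G\big(\nabla f(q_1)-\nabla f(q_0),\dots,\nabla f(q_m)-\nabla f(q_0)\big)^{-1}\begin{pmatrix}\beta_1-\langle\nabla f(q_0),\nabla f(q_1)-\nabla f(q_0)\rangle\\ \vdots\\ \beta_m-\langle\nabla f(q_0),\nabla f(q_m)-\nabla f(q_0)\rangle\end{pmatrix}$$ and, for every $i\in\{1,\dots,m\}$, $\beta_i=\langle\nabla f(q_i),q_i\rangle-f(q_i)-(\langle\nabla f(q_0),q_0\rangle-f(q_0))$.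
   Context: $\Gamma_0(\mathcal{H})$ is the set of proper closed convex functions $\mathcal{H}\to\,]-\infty,+\infty]$; $\operatorname{aff}$ denotes affine hull. The Gram matrix $G(a_1,\dots,a_m)$ is the $m\times m$ matrix with $(i,j)$ entry $\langle a_i,a_j\rangle$. The Bregman distance is $D_f(x,y)=f(x)-f(y)-\langle\nabla f(y),x-y\rangle$ if $y\in\operatorname{int}\operatorname{dom} f$, and $+\infty$ otherwise. $\overleftarrow{E}_f(\mathcal{S})=\{x\in\operatorname{dom} f:\ D_f(x,q_0)=D_f(x,q_1)=\cdots=D_f(x,q_m)\}$. The backward Bregman pseudo-circumcenter set of $\mathcal{S}$ is $\overleftarrow{CC}^{ps}_f(\mathcal{S})=\operatorname{aff}(\nabla f(\mathcal{S}))\cap\overleftarrow{E}_f(\mathcal{S})$. *)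

theory Defs
  imports
    "HOL-Analysis.Analysis"
    "HOL-Library.Extended_Real"
    "Jordan_Normal_Form.Gauss_Jordan_Elimination"
begin

definition edom :: "('a \<Rightarrow> ereal) \<Rightarrow> 'a set" where
  "edom f = {x. f x < \<infinity>}"

definition epi :: "('a \<Rightarrow> ereal) \<Rightarrow> ('a \<times> real) set" where
  "epi f = {(x, r). f x \<le> ereal r}"

text \<open>Convexity and closedness (lower semicontinuity) of an extended real valued function are
  convexity and closedness of its epigraph.\<close>

definition Gamma0 :: "('a::real_inner \<Rightarrow> ereal) set" where
  "Gamma0 = {f. (\<forall>x. f x \<noteq> -\<infinity>) \<and> edom f \<noteq> {} \<and> convex (epi f) \<and> closed (epi f)}"

text \<open>The difference quotient is taken in the extended reals.  If \<open>f x\<close> is infinite, it is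
  infinite for all \<open>t > 0\<close>, so the predicate only holds at points where \<open>f\<close> is finite.\<close>

definition has_gateaux_derivative ::
    "('a::real_normed_vector \<Rightarrow> ereal) \<Rightarrow> ('a \<Rightarrow> real) \<Rightarrow> 'a \<Rightarrow> bool" where
  "has_gateaux_derivative f D x \<longleftrightarrow> bounded_linear D \<and>
    (\<forall>y. ((\<lambda>t. (f (x + t *\<^sub>R y) - f x) / ereal t) \<longlongrightarrow> ereal (D y)) (at_right 0))"

definition gateaux_differentiable_on ::
    "('a::real_normed_vector \<Rightarrow> ereal) \<Rightarrow> 'a set \<Rightarrow> bool" where
  "gateaux_differentiable_on f S \<longleftrightarrow> (\<forall>x\<in>S. \<exists>D. has_gateaux_derivative f D x)"

text \<open>The Riesz representative of the Gateaux derivative; on a Hilbert space it exists wherever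
  the derivative does.\<close>

definition gateaux_grad :: "('a::real_inner \<Rightarrow> ereal) \<Rightarrow> 'a \<Rightarrow> 'a" where
  "gateaux_grad f x = (THE g. has_gateaux_derivative f (inner g) x)"

lemma gateaux_grad_eqI:
  assumes "has_gateaux_derivative f (inner g) x"
  shows "gateaux_grad f x = g"
proof -
  have "h = g" if h: "has_gateaux_derivative f (inner h) x" for h
  proof -
    have "inner h y = inner g y" for y
    proof -
      have "ereal (inner h y) = ereal (inner g y)"
        using assms h tendsto_unique[OF trivial_limit_at_right_real]
        unfolding has_gateaux_derivative_def by blast
      then show ?thesis by simp
    qed
    then show "h = g"
      by (metis inner_commute vector_eq_ldot)
  qed
  then show ?thesis
    unfolding gateaux_grad_def using assms by blast
qed

definition bregman :: "('a::real_inner \<Rightarrow> ereal) \<Rightarrow> 'a \<Rightarrow> 'a \<Rightarrow> ereal" where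
  "bregman f x y =
    (if y \<in> interior (edom f) then f x - f y - ereal (inner (gateaux_grad f y) (x - y)) else \<infinity>)"

definition backward_E :: "('a::real_inner \<Rightarrow> ereal) \<Rightarrow> 'a set \<Rightarrow> 'a set" where
  "backward_E f S = {x \<in> edom f. \<forall>y\<in>S. \<forall>z\<in>S. bregman f x y = bregman f x z}"

definition backward_CC_ps :: "('a::real_inner \<Rightarrow> ereal) \<Rightarrow> 'a set \<Rightarrow> 'a set" where
  "backward_CC_ps f S = (affine hull (gateaux_grad f ` S)) \<inter> backward_E f S"

text \<open>Affine independence of the family \<open>a 0, \<dots>, a m\<close>: unlike for sets, repetitions are excluded.\<close>

definition affinely_independent_family :: "nat \<Rightarrow> (nat \<Rightarrow> 'a::real_vector) \<Rightarrow> bool" where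
  "affinely_independent_family m a \<longleftrightarrow> inj_on a {0..m} \<and> \<not> affine_dependent (a ` {0..m})"

text \<open>Indices are 0-based: this is the Gram matrix of \<open>a 0, \<dots>, a (m - 1)\<close>.\<close>

definition gram_matrix :: "nat \<Rightarrow> (nat \<Rightarrow> 'a::real_inner) \<Rightarrow> real Matrix.mat" where
  "gram_matrix m a = Matrix.mat m m (\<lambda>(i, j). inner (a i) (a j))"

end

(* For x in dom f, all D_f(x, q_i) agree iff <g_i - g_0, x> = beta_i for i = 1, ..., m, where g_i is the
   gradient at q_i.  Writing a point of the affine hull of the g_i as g_0 plus a combination of the
   g_i - g_0 with coefficient vector c, these equations become a linear system for c whose matrix is the
   Gram matrix of the g_i - g_0; affine independence makes it invertible. *)

theory Submission
  imports Defs "Jordan_Normal_Form.Determinant"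
begin

text \<open>Induction on \<open>A\<close>, splitting off one generator at a time. Coefficients are
  attached to indices rather than to vectors, so \<open>h\<close> may repeat values.\<close>

lemma span_image_finite:
  fixes h :: "'i \<Rightarrow> 'a::real_vector"
  assumes "finite A"
  shows "span (h ` A) = range (\<lambda>c. \<Sum>i\<in>A. c i *\<^sub>R h i)"
proof
  show "range (\<lambda>c. \<Sum>i\<in>A. c i *\<^sub>R h i) \<subseteq> span (h ` A)"
    by (intro image_subsetI span_sum span_scale span_base imageI)
  have "\<exists>c. x = (\<Sum>i\<in>A. c i *\<^sub>R h i)" if "x \<in> span (h ` A)" for x
    using assms that
  proof (induction A arbitrary: x rule: finite_induct)
    case empty
    then show ?case by simp
  next
    case (insert a A)
    then obtain k where "x - k *\<^sub>R h a \<in> span (h ` A)"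
      by (auto simp: span_breakdown_eq)
    then obtain c where c: "x - k *\<^sub>R h a = (\<Sum>i\<in>A. c i *\<^sub>R h i)"
      using insert.IH by blast
    have "(\<Sum>i\<in>A. (c(a := k)) i *\<^sub>R h i) = (\<Sum>i\<in>A. c i *\<^sub>R h i)"
      using insert.hyps by (intro sum.cong) auto
    then have "x = (\<Sum>i\<in>insert a A. (c(a := k)) i *\<^sub>R h i)"
      using insert.hyps c by (simp add: diff_eq_eq add.commute)
    then show ?case by blast
  qed
  then show "span (h ` A) \<subseteq> range (\<lambda>c. \<Sum>i\<in>A. c i *\<^sub>R h i)" by blast
qed

text \<open>With \<open>g 0\<close> as base point, the hull is a translate of the span of the
  differences. Only the values of \<open>c\<close> below \<open>m\<close> matter.\<close>

lemma affine_hull_family: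
  fixes g :: "nat \<Rightarrow> 'a::real_vector"
  shows "affine hull (g ` {0..m}) = range (\<lambda>c. g 0 + (\<Sum>i<m. c i *\<^sub>R (g (Suc i) - g 0)))"
proof -
  have "{0..m} = insert 0 (Suc ` {..<m})"
    unfolding atLeast0AtMost lessThan_Suc_atMost[symmetric] by (rule lessThan_Suc_eq_insert_0)
  then have "g ` {0..m} = insert (g 0) ((\<lambda>i. g (Suc i)) ` {..<m})"
    by (simp add: image_image)
  then show ?thesis
    by (simp add: affine_hull_insert_span_gen image_image span_image_finite)
qed

text \<open>A nontrivial linear relation among the differences becomes an affine dependence of the
  points once \<open>g 0\<close> receives the coefficient that makes the total zero.\<close>

lemma affinely_independent_family_differences:
  assumes "affinely_independent_family m g"
    and zero: "(\<Sum>i<m. c i *\<^sub>R (g (Suc i) - g 0)) = 0"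
    and "i < m"
  shows "c i = 0"
proof (rule ccontr)
  assume "c i \<noteq> 0"
  have inj: "inj_on g {0..m}" and ndep: "\<not> affine_dependent (g ` {0..m})"
    using assms(1) by (auto simp: affinely_independent_family_def)
  \<comment> \<open>\<open>case_nat\<close> shifts \<open>c\<close> up by one index and places the
    balancing coefficient at index 0.\<close>
  define d where "d = case_nat (- (\<Sum>i<m. c i)) c"
  \<comment> \<open>\<open>affine_dependent\<close> speaks of sets, so the coefficients must be
    carried from indices to vectors; injectivity of \<open>g\<close> makes this faithful.\<close>
  define U where "U v = d (inv_into {0..m} g v)" for v
  have U: "U (g j) = d j" if "j \<in> {0..m}" for j
    using inj that by (simp add: U_def)
  have "sum U (g ` {0..m}) = (\<Sum>j\<in>{0..m}. d j)"
    using U by (simp add: sum.reindex[OF inj])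
  also have "\<dots> = 0"
    by (simp add: atLeast0AtMost sum.atMost_shift d_def)
  finally have "sum U (g ` {0..m}) = 0" .
  moreover have "(\<Sum>v\<in>g ` {0..m}. U v *\<^sub>R v) = (\<Sum>j\<in>{0..m}. d j *\<^sub>R g j)"
    using U by (simp add: sum.reindex[OF inj])
  then have "(\<Sum>v\<in>g ` {0..m}. U v *\<^sub>R v) = 0"
    using zero by (simp add: atLeast0AtMost sum.atMost_shift d_def scaleR_diff_right
        sum_subtractf scaleR_sum_left)
  moreover have "U (g (Suc i)) \<noteq> 0" "g (Suc i) \<in> g ` {0..m}"
    using U[of "Suc i"] \<open>i < m\<close> \<open>c i \<noteq> 0\<close> by (auto simp: d_def)
  ultimately have "affine_dependent (g ` {0..m})"
    unfolding affine_dependent_explicit_finite[OF finite_imageI[OF finite_atLeastAtMost]] by blast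
  then show False using ndep by blast
qed

lemma gram_matrix_carrier: "gram_matrix m a \<in> carrier_mat m m"
  by (simp add: gram_matrix_def)

text \<open>Bilinearity of the inner product; this translates between matrix equations and inner
  products with a combination of the \<open>a j\<close>.\<close>

lemma gram_matrix_mult_vec:
  assumes "v \<in> carrier_vec m" "i < m"
  shows "vec_index (gram_matrix m a *\<^sub>v v) i = inner (a i) (\<Sum>j<m. vec_index v j *\<^sub>R a j)"
  using assms
  by (simp add: gram_matrix_def scalar_prod_def inner_sum_right atLeast0LessThan mult.commute)

text \<open>A kernel vector \<open>v\<close> yields a combination \<open>s\<close> of the
  \<open>a j\<close> that is orthogonal to every \<open>a i\<close>, hence to itself. So
  \<open>s = 0\<close>, and independence forces \<open>v\<close> to vanish.\<close>

lemma det_gram_matrix_nonzero: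
  assumes indep: "\<And>c i. (\<Sum>j<m. c j *\<^sub>R a j) = 0 \<Longrightarrow> i < m \<Longrightarrow> c i = 0"
  shows "det (gram_matrix m a) \<noteq> 0"
proof
  assume "det (gram_matrix m a) = 0"
  then obtain v where v: "v \<in> carrier_vec m" "v \<noteq> 0\<^sub>v m" "gram_matrix m a *\<^sub>v v = 0\<^sub>v m"
    using det_0_iff_vec_prod_zero_field[OF gram_matrix_carrier] by blast
  define s where "s = (\<Sum>j<m. vec_index v j *\<^sub>R a j)"
  have "inner (a i) s = 0" if "i < m" for i
    using gram_matrix_mult_vec[OF v(1) that, of a] v(3) that by (simp add: s_def)
  then have "inner s s = 0"
    by (subst s_def) (simp add: inner_sum_left)
  then have "vec_index v i = 0" if "i < m" for i
    using indep[of "vec_index v", OF _ that] by (simp add: s_def)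
  then have "v = 0\<^sub>v m"
    using v(1) by (intro eq_vecI) auto
  then show False using v(2) by blast
qed

lemma mat_inverse_det_nonzero:
  fixes A :: "'k::field mat"
  assumes "A \<in> carrier_mat n n" "det A \<noteq> 0"
  obtains B where "mat_inverse A = Some B" "A * B = 1\<^sub>m n" "B * A = 1\<^sub>m n" "B \<in> carrier_mat n n"
proof (cases "mat_inverse A")
  case None
  then show ?thesis
    \<comment> \<open>\<open>None\<close> would mean that \<open>A\<close> is not a unit of the
      matrix ring. The argument \<open>()\<close> fixes the same ring record in both facts.\<close>
    using mat_inverse(1)[OF assms(1), of "()"] det_non_zero_imp_unit[OF assms, of "()"] by blast
next
  case (Some B)
  then show ?thesis
    using mat_inverse(2)[OF assms(1) Some] that by blast
qed

text \<open>The finite value \<open>f x\<close> cancels, and what remains on each side is affine in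
  \<open>x\<close>.\<close>

lemma bregman_eq_iff:
  assumes f: "f \<in> Gamma0" and "x \<in> edom f"
    and y: "y \<in> interior (edom f)" and z: "z \<in> interior (edom f)"
  shows "bregman f x y = bregman f x z \<longleftrightarrow>
    inner (gateaux_grad f y - gateaux_grad f z) x =
      inner (gateaux_grad f y) y - real_of_ereal (f y)
        - (inner (gateaux_grad f z) z - real_of_ereal (f z))"
proof -
  have fin: "\<exists>r. f w = ereal r" if "w \<in> edom f" for w
    using f that by (cases "f w") (auto simp: Gamma0_def edom_def)
  \<comment> \<open>All three values are finite, so the extended real arithmetic reduces to real
    arithmetic.\<close>
  obtain a b c where "f x = ereal a" "f y = ereal b" "f z = ereal c"
    using fin assms(2) subsetD[OF interior_subset y] subsetD[OF interior_subset z] by metis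
  then show ?thesis
    using y z by (auto simp: bregman_def algebra_simps)
qed

text \<open>Equality of all the distances follows from equality with the one at \<open>q 0\<close>,
  and each such comparison is a linear equation in \<open>x\<close>.\<close>

lemma backward_E_iff:
  assumes f: "f \<in> Gamma0" and q: "q ` {0..m} \<subseteq> interior (edom f)" and x: "x \<in> edom f"
  shows "x \<in> backward_E f (q ` {0..m}) \<longleftrightarrow>
    (\<forall>i<m. inner (gateaux_grad f (q (Suc i)) - gateaux_grad f (q 0)) x =
      inner (gateaux_grad f (q (Suc i))) (q (Suc i)) - real_of_ereal (f (q (Suc i)))
        - (inner (gateaux_grad f (q 0)) (q 0) - real_of_ereal (f (q 0))))"
    (is "_ \<longleftrightarrow> ?R")
proof -
  have "x \<in> backward_E f (q ` {0..m}) \<longleftrightarrow> (\<forall>i<m. bregman f x (q (Suc i)) = bregman f x (q 0))"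
  proof
    assume "x \<in> backward_E f (q ` {0..m})"
    then show "\<forall>i<m. bregman f x (q (Suc i)) = bregman f x (q 0)"
      unfolding backward_E_def by simp
  next
    assume *: "\<forall>i<m. bregman f x (q (Suc i)) = bregman f x (q 0)"
    have "bregman f x (q i) = bregman f x (q 0)" if "i \<in> {0..m}" for i
      using * that by (cases i) simp_all
    then have "\<forall>y\<in>q ` {0..m}. bregman f x y = bregman f x (q 0)"
      by blast
    then have "bregman f x y = bregman f x z" if "y \<in> q ` {0..m}" "z \<in> q ` {0..m}" for y z
      using that by (blast intro: trans sym)
    then show "x \<in> backward_E f (q ` {0..m})"
      unfolding backward_E_def using x by blast
  qed
  also have "\<dots> \<longleftrightarrow> ?R"
  proof -
    have "q i \<in> interior (edom f)" if "i \<le> m" for i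
      using q that by (simp add: subset_iff)
    then have "bregman f x (q (Suc i)) = bregman f x (q 0) \<longleftrightarrow>
        inner (gateaux_grad f (q (Suc i)) - gateaux_grad f (q 0)) x =
        inner (gateaux_grad f (q (Suc i))) (q (Suc i)) - real_of_ereal (f (q (Suc i)))
          - (inner (gateaux_grad f (q 0)) (q 0) - real_of_ereal (f (q 0)))" if "i < m" for i
      using that by (intro bregman_eq_iff[OF f x]) simp_all
    then show ?thesis by blast
  qed
  finally show ?thesis .
qed

theorem theorem3p14:
  fixes f :: "'a::{real_inner, complete_space} \<Rightarrow> ereal"
    and q :: "nat \<Rightarrow> 'a" and m :: nat
  assumes "f \<in> Gamma0"
    and "interior (edom f) \<noteq> {}"
    and "gateaux_differentiable_on f (interior (edom f))"
    and "m \<ge> 1"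
    and "q ` {0..m} \<subseteq> interior (edom f)"
    and "affinely_independent_family m (\<lambda>i. gateaux_grad f (q i))"
    and "affine hull (gateaux_grad f ` (q ` {0..m})) \<subseteq> edom f"
  shows "backward_CC_ps f (q ` {0..m}) \<noteq> {} \<and>
    (let g = (\<lambda>i. gateaux_grad f (q i));
         \<beta> = (\<lambda>i. inner (g i) (q i) - real_of_ereal (f (q i))
                   - (inner (g 0) (q 0) - real_of_ereal (f (q 0))));
         G = gram_matrix m (\<lambda>i. g (Suc i) - g 0);
         \<alpha> = the (mat_inverse G) *\<^sub>v
               Matrix.vec m (\<lambda>i. \<beta> (Suc i) - inner (g 0) (g (Suc i) - g 0))
     in invertible_mat G \<and>
        backward_CC_ps f (q ` {0..m}) =
          {g 0 + (\<Sum>i\<in>{1..m}. Matrix.vec_index \<alpha> (i - 1) *\<^sub>R (g i - g 0))})"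
proof -
  define g where "g = (\<lambda>i. gateaux_grad f (q i))"
  define \<beta> where "\<beta> = (\<lambda>i. inner (g i) (q i) - real_of_ereal (f (q i))
    - (inner (g 0) (q 0) - real_of_ereal (f (q 0))))"
  \<comment> \<open>Vectors and matrices are indexed from 0, so entry \<open>i\<close> belongs to
    the point \<open>q (Suc i)\<close>.\<close>
  define a where "a = (\<lambda>i. g (Suc i) - g 0)"
  define G where "G = gram_matrix m a"
  define b where "b = Matrix.vec m (\<lambda>i. \<beta> (Suc i) - inner (g 0) (a i))"
  define \<alpha> where "\<alpha> = the (mat_inverse G) *\<^sub>v b"
  define p where "p c = g 0 + (\<Sum>i<m. c i *\<^sub>R a i)" for c :: "nat \<Rightarrow> real"
  have G: "G \<in> carrier_mat m m"
    by (simp add: G_def gram_matrix_carrier)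
  have "det G \<noteq> 0"
    unfolding G_def a_def
    using affinely_independent_family_differences assms(6) g_def
    by (intro det_gram_matrix_nonzero) blast
  then obtain B where B: "mat_inverse G = Some B" "G * B = 1\<^sub>m m" "B * G = 1\<^sub>m m" "B \<in> carrier_mat m m"
    using mat_inverse_det_nonzero[OF G] by blast
  have b: "b \<in> carrier_vec m" by (simp add: b_def)
  have \<alpha>: "\<alpha> \<in> carrier_vec m" using B b by (simp add: \<alpha>_def)
  have inv: "invertible_mat G"
    using G B by (auto simp: invertible_mat_def inverts_mat_def)
  \<comment> \<open>The direction from left to right gives uniqueness of the pseudo-circumcenter,
    the converse its existence.\<close>
  have solve: "G *\<^sub>v v = b \<longleftrightarrow> v = \<alpha>" if v: "v \<in> carrier_vec m" for v
  proof
    assume "G *\<^sub>v v = b"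
    then have "\<alpha> = B * G *\<^sub>v v"
      using B(1,4) G v by (simp add: \<alpha>_def)
    then show "v = \<alpha>" using B(3) v by simp
  next
    assume "v = \<alpha>"
    then have "G *\<^sub>v v = G * B *\<^sub>v b"
      using B(1,4) G b by (simp add: \<alpha>_def)
    then show "G *\<^sub>v v = b" using B(2) b by simp
  qed
  have hull: "affine hull (gateaux_grad f ` (q ` {0..m})) = range p"
    using affine_hull_family[of g m] by (simp add: image_image g_def p_def a_def)
  have p_in_E: "p c \<in> backward_E f (q ` {0..m}) \<longleftrightarrow> Matrix.vec m c = \<alpha>" for c
  proof -
    \<comment> \<open>Since the affine hull lies in the domain, membership in
      \<open>backward_E\<close> comes down to the linear equations alone.\<close>
    have "p c \<in> edom f" using assms(7) hull by auto
    then have "p c \<in> backward_E f (q ` {0..m}) \<longleftrightarrow> (\<forall>i<m. inner (a i) (p c) = \<beta> (Suc i))"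
      using backward_E_iff[OF assms(1) assms(5)] by (simp add: a_def g_def \<beta>_def)
    \<comment> \<open>Pairing \<open>a i\<close> with \<open>p c\<close> gives
      \<open>inner (g 0) (a i)\<close> plus entry \<open>i\<close> of the Gram product; moving the
      first term to the right turns \<beta> into \<open>b\<close>.\<close>
    also have "\<dots> \<longleftrightarrow> (\<forall>i<m. vec_index (G *\<^sub>v Matrix.vec m c) i = vec_index b i)"
      by (auto simp: G_def gram_matrix_mult_vec b_def p_def inner_add_right inner_commute[of "g 0"])
    also have "\<dots> \<longleftrightarrow> G *\<^sub>v Matrix.vec m c = b"
      using G b by auto
    also have "\<dots> \<longleftrightarrow> Matrix.vec m c = \<alpha>"
      by (rule solve) simp
    finally show ?thesis .
  qed
  have "backward_CC_ps f (q ` {0..m}) = {p (vec_index \<alpha>)}"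
  proof (intro equalityI subsetI)
    fix x assume "x \<in> backward_CC_ps f (q ` {0..m})"
    then obtain c where c: "x = p c" "Matrix.vec m c = \<alpha>"
      using p_in_E by (auto simp: backward_CC_ps_def hull)
    \<comment> \<open>\<open>c\<close> and \<open>vec_index \<alpha>\<close> may differ from index
      \<open>m\<close> on, but \<open>p\<close> reads only the indices below
      \<open>m\<close>.\<close>
    then have "p c = p (vec_index \<alpha>)"
      by (auto simp: p_def)
    then show "x \<in> {p (vec_index \<alpha>)}" using c by simp
  next
    fix x assume "x \<in> {p (vec_index \<alpha>)}"
    moreover have "Matrix.vec m (vec_index \<alpha>) = \<alpha>"
      using \<alpha> by auto
    ultimately show "x \<in> backward_CC_ps f (q ` {0..m})"
      using p_in_E by (auto simp: backward_CC_ps_def hull)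
  qed
  moreover have "p (vec_index \<alpha>) = g 0 + (\<Sum>i\<in>{1..m}. vec_index \<alpha> (i - 1) *\<^sub>R (g i - g 0))"
    by (simp add: p_def a_def sum.atLeast1_atMost_eq)
  ultimately show ?thesis
    using inv by (simp add: Let_def g_def \<beta>_def a_def G_def b_def \<alpha>_def)
qed

end
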